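(* Let $\theta = p/q \in (0,1]$, where $p$ and $q$ are positive integers such that $p$ divides $q+1$, and let $(a_i)_{i=1}^\infty$ be the infinite greedy underapproximation sequence of $\theta$. For every positive integer $n$, if $(x_i)_{i=1}^n$ is a sequence of integers with $2 \leq x_1 \leq \cdots \leq x_n$ such that \[ \sum_{i=1}^n \frac{1}{a_i} \leq \sum_{i=1}^n \frac{1}{x_i} < \frac{p}{q}, \] then $x_i = a_i$ for all $i = 1,\ldots,n$.
   Context: For $\theta \in (0,1]$ let $G(\theta) = \lfloor 1/\theta \rfloor + 1$; equivalently $G(\theta)$ is the unique integer $a \geq 2$ with $1/a < \theta \leq 1/(a-1)$. The infinite greedy underapproximation sequence $(a_i)_{i=1}^\infty$ of $\theta\in(0,1]$ is defined by $a_1 = G(\theta)$ and $a_{i+1} = G\left(\theta - \sum_{j=1}^i \frac{1}{a_j}\right)$ for all $i \geq 1$. *)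

theory Defs
  imports Complex_Main
begin

text \<open>Only arguments in the interval \<open>(0, 1]\<close> are meaningful.\<close>

definition greedy_G :: "real \<Rightarrow> int" where
  "greedy_G \<theta> = \<lfloor>1 / \<theta>\<rfloor> + 1"

text \<open>The sequence is indexed from 1; the value at index 0 carries no meaning. At index 1
  the sum is empty.\<close>

fun greedy_under :: "real \<Rightarrow> nat \<Rightarrow> int" where
  "greedy_under \<theta> i = greedy_G (\<theta> - (\<Sum>j\<in>{1..<i}. 1 / real_of_int (greedy_under \<theta> j)))"

declare greedy_under.simps [simp del]

lemma greedy_under_1: "greedy_under \<theta> 1 = greedy_G \<theta>"
  by (subst greedy_under.simps) simp

lemma greedy_under_Suc:
  "greedy_under \<theta> (i + 1) = greedy_G (\<theta> - (\<Sum>j=1..i. 1 / real_of_int (greedy_under \<theta> j)))"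
  by (subst greedy_under.simps) (simp add: atLeastLessThanSuc_atLeastAtMost)

end

theory Submission
  imports Defs
begin

text \<open>When \<open>p\<close> divides \<open>q + 1\<close>, the remainder left by the greedy sequence after \<open>n \<ge> 1\<close> steps is
  exactly \<open>1 / (q a\<^sub>1 \<cdots> a\<^sub>n)\<close>, while any other denominators leave a positive remainder which is a
  multiple of \<open>1 / (q x\<^sub>1 \<cdots> x\<^sub>n)\<close>. Hence a competitor satisfies \<open>\<Prod> a\<^sub>i \<le> \<Prod> x\<^sub>i\<close>. By induction
  on \<open>n\<close>, every proper partial sum of the \<open>1 / x\<^sub>i\<close> is at most that of the \<open>1 / a\<^sub>i\<close>, so
  summation by parts gives \<open>\<Sum> x\<^sub>i / a\<^sub>i \<le> n\<close>. The equality case of the inequality of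
  arithmetic and geometric means then forces \<open>x\<^sub>i = a\<^sub>i\<close>.\<close>

lemma greedy_G_inverse_int: "greedy_G (1 / real_of_int m) = m + 1"
  by (simp add: greedy_G_def)

text \<open>Writing \<open>q + 1 = p * c\<close> gives \<open>q / p = c - 1 / p\<close>, which lies
  in the interval from \<open>c - 1\<close> (included) to \<open>c\<close> (excluded).\<close>

lemma greedy_G_dvd:
  fixes p q :: nat
  assumes "p > 0" "p dvd q + 1"
  shows "greedy_G (real p / real q) = int ((q + 1) div p)"
proof -
  obtain c where c: "q + 1 = p * c"
    using assms(2) by (auto elim: dvdE)
  have "real q = real p * real c - 1"
    using c by (metis add_diff_cancel_right' of_nat_1 of_nat_add of_nat_mult)
  then have "real q / real p = real c - 1 / real p"
    using assms(1) by (simp add: field_simps)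
  then have "\<lfloor>real q / real p\<rfloor> = int c - 1"
    using assms(1) by (intro floor_unique) (auto simp: field_simps)
  then show ?thesis
    using c assms(1) by (simp add: greedy_G_def)
qed

text \<open>Divisibility makes the first remainder a unit fraction, since
  \<open>p * c - q = 1\<close>. From a remainder \<open>1 / M\<close> the greedy choice is
  \<open>M + 1\<close>, and \<open>1 / M - 1 / (M + 1) = 1 / (M * (M + 1))\<close> is again a unit
  fraction.\<close>

lemma greedy_under_remainder:
  fixes p q n :: nat
  assumes "p > 0" "q > 0" "p dvd q + 1" "n \<ge> 1"
  defines "a \<equiv> greedy_under (real p / real q)"
  shows "(\<forall>i\<in>{1..n}. a i > 0) \<and>
    real p / real q - (\<Sum>i=1..n. 1 / real_of_int (a i)) = 1 / (real q * (\<Prod>i=1..n. real_of_int (a i)))"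
  using assms(4)
proof (induction n rule: nat_induct_at_least)
  case base
  obtain c where c: "q + 1 = p * c"
    using assms(3) by (auto elim: dvdE)
  have "c > 0"
    using c by (cases c) auto
  have a1: "a 1 = int c"
    using greedy_G_dvd[OF assms(1,3)] c assms(1) by (simp add: a_def greedy_under_1[simplified])
  have "real p * real c = real q + 1"
    using c by (metis of_nat_1 of_nat_add of_nat_mult)
  then have "real p / real q - 1 / real c = 1 / (real q * real c)"
    using \<open>c > 0\<close> assms(2) by (simp add: field_simps)
  then show ?case
    using a1 \<open>c > 0\<close> by simp
next
  case (Suc n)
  define M where "M = int q * (\<Prod>i=1..n. a i)"
  have "M > 0"
    using Suc.IH assms(2) by (auto simp: M_def intro!: mult_pos_pos prod_pos)
  have rem: "real p / real q - (\<Sum>i=1..n. 1 / real_of_int (a i)) = 1 / real_of_int M"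
    using Suc.IH by (simp add: M_def)
  have aSuc: "a (Suc n) = M + 1"
    using greedy_under_Suc[of "real p / real q" n] rem greedy_G_inverse_int[of M]
    by (simp add: a_def)
  have "real p / real q - (\<Sum>i=1..Suc n. 1 / real_of_int (a i))
      = 1 / real_of_int M - 1 / (real_of_int M + 1)"
    using rem aSuc by simp
  also have "\<dots> = 1 / (real_of_int M * (real_of_int M + 1))"
    using \<open>M > 0\<close> by (simp add: field_simps)
  also have "\<dots> = 1 / (real q * (\<Prod>i=1..Suc n. real_of_int (a i)))"
    using aSuc by (simp add: M_def mult.assoc)
  finally show ?case
    using Suc.IH aSuc \<open>M > 0\<close> by (auto simp: le_Suc_eq)
qed

lemma prod_mult_sum_inverse_Ints:
  fixes x :: "nat \<Rightarrow> int"
  assumes "\<And>i. i \<in> {1..n} \<Longrightarrow> x i \<noteq> 0"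
  shows "(\<Prod>i=1..n. real_of_int (x i)) * (\<Sum>i=1..n. 1 / real_of_int (x i)) \<in> \<int>"
proof -
  have "(\<Prod>i=1..n. real_of_int (x i)) * (1 / real_of_int (x j)) \<in> \<int>" if "j \<in> {1..n}" for j
  proof -
    have "(\<Prod>i=1..n. real_of_int (x i)) * (1 / real_of_int (x j))
        = (\<Prod>i\<in>{1..n} - {j}. real_of_int (x i))"
      using that assms[OF that] by (simp add: prod.remove)
    then show ?thesis
      by (auto intro: Ints_prod)
  qed
  then show ?thesis
    by (auto simp: sum_distrib_left intro!: Ints_sum simp del: times_divide_eq_right)
qed

text \<open>Multiplication by \<open>q\<close> and all the \<open>x i\<close> clears every
  denominator, so the positive remainder becomes a positive integer, hence at least 1.\<close>

lemma remainder_ge: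
  fixes p q n :: nat and x :: "nat \<Rightarrow> int"
  assumes "q > 0" and pos: "\<And>i. i \<in> {1..n} \<Longrightarrow> x i > 0"
    and less: "(\<Sum>i=1..n. 1 / real_of_int (x i)) < real p / real q"
  shows "1 / (real q * (\<Prod>i=1..n. real_of_int (x i)))
    \<le> real p / real q - (\<Sum>i=1..n. 1 / real_of_int (x i))"
proof -
  define P S where "P = (\<Prod>i=1..n. real_of_int (x i))" and "S = (\<Sum>i=1..n. 1 / real_of_int (x i))"
  have "P > 0"
    using pos by (auto simp: P_def intro!: prod_pos)
  have "P \<in> \<int>"
    by (auto simp: P_def intro: Ints_prod)
  have "x i \<noteq> 0" if "i \<in> {1..n}" for i
    using pos[OF that] by simp
  then have "P * S \<in> \<int>"
    unfolding P_def S_def by (rule prod_mult_sum_inverse_Ints)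
  have eq: "real q * P * (real p / real q - S) = real p * P - real q * (P * S)"
    using assms(1) by (simp add: field_simps)
  have "real q * P * (real p / real q - S) \<in> \<int>"
    unfolding eq
    by (intro Ints_diff Ints_mult[OF _ \<open>P \<in> \<int>\<close>] Ints_mult[OF _ \<open>P * S \<in> \<int>\<close>] Ints_of_nat)
  then obtain k where k: "real q * P * (real p / real q - S) = real_of_int k"
    by (rule Ints_cases)
  have "real q * P * (real p / real q - S) > 0"
    using assms(1) \<open>P > 0\<close> less by (simp add: S_def)
  then have "real q * P * (real p / real q - S) \<ge> 1"
    unfolding k by simp
  then show ?thesis
    using assms(1) \<open>P > 0\<close> unfolding P_def[symmetric] S_def[symmetric]
    by (simp add: pos_divide_le_eq mult.commute)
qed

text \<open>Summation by parts: each increment of \<open>w\<close> multiplies a proper partial sum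
  of \<open>d\<close>. The full sum may have any sign; in the application it is nonpositive.\<close>

lemma sum_mult_le_last_mult_sum:
  fixes w d :: "nat \<Rightarrow> real"
  assumes "n \<ge> 1" "\<And>i. i \<in> {1..<n} \<Longrightarrow> w i \<le> w (Suc i)"
    and "\<And>j. j \<in> {1..<n} \<Longrightarrow> 0 \<le> (\<Sum>i=1..j. d i)"
  shows "(\<Sum>i=1..n. w i * d i) \<le> w n * (\<Sum>i=1..n. d i)"
  using assms
proof (induction n rule: nat_induct_at_least)
  case base
  then show ?case by simp
next
  case (Suc n)
  have "(\<Sum>i=1..n. w i * d i) \<le> w n * (\<Sum>i=1..n. d i)"
    using Suc.prems by (intro Suc.IH) auto
  also have "\<dots> \<le> w (Suc n) * (\<Sum>i=1..n. d i)"
    using Suc.prems Suc.hyps by (intro mult_right_mono) auto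
  finally show ?case
    by (simp add: distrib_left)
qed

text \<open>Each \<open>r i - 1 - ln (r i)\<close> is nonnegative and vanishes only at
  \<open>r i = 1\<close>, while the hypotheses make the sum of these terms at most 0.\<close>

lemma eq_1_if_prod_ge_sum_le:
  fixes r :: "'a \<Rightarrow> real"
  assumes fin: "finite A" and pos: "\<And>i. i \<in> A \<Longrightarrow> r i > 0"
    and prod: "1 \<le> prod r A" and sum: "(\<Sum>i\<in>A. r i - 1) \<le> 0"
    and i: "i \<in> A"
  shows "r i = 1"
proof -
  have "0 \<le> ln (prod r A)"
    using prod by simp
  also have "\<dots> = (\<Sum>i\<in>A. ln (r i))"
  proof (rule ln_prod[OF fin])
    show "r i \<noteq> 0" if "i \<in> A" for i
      using pos[OF that] by simp
  qed
  finally have "(\<Sum>i\<in>A. r i - 1 - ln (r i)) \<le> 0"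
    using sum by (simp add: sum_subtractf)
  moreover have nonneg: "0 \<le> r i - 1 - ln (r i)" if "i \<in> A" for i
    using ln_le_minus_one[OF pos[OF that]] by simp
  ultimately have "(\<Sum>i\<in>A. r i - 1 - ln (r i)) = 0"
    by (intro order_antisym sum_nonneg nonneg)
  then have "r i - 1 - ln (r i) = 0"
    using sum_nonneg_0[OF fin nonneg] i by simp
  then show ?thesis
    using pos[OF i] by (intro ln_eq_minus_one) auto
qed

theorem theorem4p2:
  fixes \<theta> :: real and p q n :: nat and a x :: "nat \<Rightarrow> int"
  assumes "p > 0" and "q > 0"
    and "\<theta> = real p / real q" and "\<theta> \<in> {0<..1}"
    and "p dvd q + 1"
    and "a = greedy_under \<theta>"
    and "n \<ge> 1"
    and "2 \<le> x 1" and "\<forall>i\<in>{1..<n}. x i \<le> x (i + 1)"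
    and "(\<Sum>i=1..n. 1 / real_of_int (a i)) \<le> (\<Sum>i=1..n. 1 / real_of_int (x i))"
    and "(\<Sum>i=1..n. 1 / real_of_int (x i)) < real p / real q"
  shows "\<forall>i\<in>{1..n}. x i = a i"
  using assms(7-11)
proof (induction n rule: less_induct)
  case (less n)
  have greedy: "(\<forall>i\<in>{1..n}. a i > 0) \<and>
    real p / real q - (\<Sum>i=1..n. 1 / real_of_int (a i)) = 1 / (real q * (\<Prod>i=1..n. real_of_int (a i)))"
    using greedy_under_remainder[OF assms(1,2,5) less.prems(1)] by (simp add: assms(3,6))
  have apos: "a i > 0" if "i \<in> {1..n}" for i
    using greedy that by blast
  have "2 \<le> x i" if "1 \<le> i" "i \<le> n" for i
    using that
  proof (induction i rule: nat_induct_at_least)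
    case (Suc i)
    then have "2 \<le> x i" "x i \<le> x (Suc i)"
      using less.prems(3) by auto
    then show ?case by linarith
  qed (use less.prems in simp)
  then have xpos: "x i > 0" if "i \<in> {1..n}" for i
    using that by fastforce
  then have xne: "x i \<noteq> 0" if "i \<in> {1..n}" for i
    using that by (metis less_irrefl)
  define d where "d i = 1 / real_of_int (a i) - 1 / real_of_int (x i)" for i
  have partial: "0 \<le> (\<Sum>i=1..j. d i)" if j: "j \<in> {1..<n}" for j
  \<comment> \<open>A negative partial sum would make the first \<open>j\<close> terms of
    \<open>x\<close> a competitor of length \<open>j < n\<close>; by induction they equal the greedy
    ones, so the partial sum is 0.\<close>
  proof (rule ccontr)
    assume "\<not> ?thesis"
    then have neg: "(\<Sum>i=1..j. d i) < 0"
      by simp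
    have "(\<Sum>i=1..j. 1 / real_of_int (x i)) \<le> (\<Sum>i=1..n. 1 / real_of_int (x i))"
      using j xpos by (intro sum_mono2) (auto intro: less_imp_le)
    then have "\<forall>i\<in>{1..j}. x i = a i"
      using less.prems j neg by (intro less.IH) (auto simp: d_def sum_subtractf)
    then show False
      using neg by (simp add: d_def)
  qed
  \<comment> \<open>The weights \<open>x i\<close> are chosen because
    \<open>x i * d i = x i / a i - 1\<close>.\<close>
  have "(\<Sum>i=1..n. real_of_int (x i) * d i) \<le> real_of_int (x n) * (\<Sum>i=1..n. d i)"
    using less.prems partial by (intro sum_mult_le_last_mult_sum) auto
  also have "\<dots> \<le> 0"
    using xpos[of n] less.prems by (intro mult_nonneg_nonpos) (auto simp: d_def sum_subtractf)
  finally have sum_le: "(\<Sum>i=1..n. real_of_int (x i) / real_of_int (a i) - 1) \<le> 0"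
    using xne by (simp add: d_def right_diff_distrib)
  define A X where "A = (\<Prod>i=1..n. real_of_int (a i))" and "X = (\<Prod>i=1..n. real_of_int (x i))"
  have "A > 0" "X > 0"
    using apos xpos by (auto simp: A_def X_def intro!: prod_pos)
  \<comment> \<open>The remainder left by \<open>x\<close> lies between these two values: the right
    one is exactly the greedy remainder.\<close>
  have "1 / (real q * X) \<le> 1 / (real q * A)"
    using remainder_ge[OF assms(2) xpos less.prems(5)] greedy less.prems(4)
    by (simp add: A_def X_def)
  then have "1 \<le> X / A"
    using \<open>A > 0\<close> \<open>X > 0\<close> assms(2) by (simp add: field_simps)
  then have prod_ge: "1 \<le> (\<Prod>i=1..n. real_of_int (x i) / real_of_int (a i))"
    by (simp add: A_def X_def prod_dividef)
  show ?case
  proof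
    fix i assume i: "i \<in> {1..n}"
    have "real_of_int (x i) / real_of_int (a i) = 1"
      using apos xpos i
      by (intro eq_1_if_prod_ge_sum_le[OF _ _ prod_ge sum_le]) (auto intro!: divide_pos_pos)
    then show "x i = a i"
      by (simp split: if_splits)
  qed
qed

end
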